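(* For every $d\ge1$, there is an explicit nearest-neighbor causal feedback law such that, for every $0\le L<\kappa_d$, every initial state $x_0\in\mathbb{R}^d$, every plant $f\in\mathcal F_d(L)$, and every bounded disturbance sequence $(w_t)_{t\ge1}$ in $\mathbb{R}^d$, the closed-loop state sequence of $$x_{t+1}=f(x_t)+u_t+w_{t+1}$$ is bounded, i.e. $\sup_{t\ge0}\|x_t\|<\infty$. The same law applies to all $L<\kappa_d$ and uses neither $L$, $f$, nor a bound on the disturbance. Here $$\kappa_d=\exp\left(\int_0^{1/2}\frac{t^{d-1}}{1-t^2}\,dt\right).$$
   Context: $\|\cdot\|$ is the Euclidean norm on $\mathbb{R}^d$. A causal feedback law is a sequence $\Sigma=(\Sigma_t)_{t\ge0}$ of maps $\Sigma_t\colon(\mathbb{R}^d)^{t+1}\times(\mathbb{R}^d)^t\to\mathbb{R}^d$, applied as $u_t=\Sigma_t(x_0,\dots,x_t;u_0,\dots,u_{t-1})$; together with the initial state $x_0$, the plant $f$ and the disturbance sequence $(w_t)_{t\ge1}$ it determines the closed-loop state sequence recursively. A disturbance sequence is bounded if $\sup_{t\ge1}\|w_t\|<\infty$. For $f\colon\mathbb{R}^d\to\mathbb{R}^d$, $$\|f\|_{\mathrm{gL},d}=\lim_{\alpha\to\infty}\ \sup_{x,y\in\mathbb{R}^d}\frac{\|f(x)-f(y)\|}{\|x-y\|+\alpha}\in[0,\infty],$$ and $\mathcal F_d(L)=\{f\colon\mathbb{R}^d\to\mathbb{R}^d\mid\|f\|_{\mathrm{gL},d}\le L\}$ for $L\ge0$.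 The response at time $t$ is $r_t=x_{t+1}-u_t=f(x_t)+w_{t+1}$, which is known once $x_{t+1}$ has been observed. The word "nearest-neighbor" is descriptive: it refers to a law whose control at time $t\ge1$ is based on the recorded response $r_i$ at a previously visited state $x_i$, $0\le i<t$, closest to $x_t$. *)

theory Defs
  imports "HOL-Analysis.Analysis"
begin

definition gL_quotient :: "(real ^ 'd \<Rightarrow> real ^ 'd) \<Rightarrow> real \<Rightarrow> ennreal" where
  "gL_quotient f \<alpha> = (SUP x. SUP y. ennreal (norm (f x - f y) / (norm (x - y) + \<alpha>)))"

definition gL_norm :: "(real ^ 'd \<Rightarrow> real ^ 'd) \<Rightarrow> ennreal" where
  "gL_norm f = Lim at_top (gL_quotient f)"

text \<open>The limit in \<open>gL_norm\<close> exists for every \<open>f\<close>, since the quotient decreases in \<open>\<alpha> > 0\<close>.\<close>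

lemma gL_quotient_antimono:
  assumes "0 < a" "a \<le> b"
  shows "gL_quotient f b \<le> gL_quotient f a"
  unfolding gL_quotient_def
proof (intro SUP_mono' ennreal_leI divide_left_mono)
  fix x y :: "real ^ 'a"
  show "norm (x - y) + a \<le> norm (x - y) + b" using assms by simp
  show "0 < (norm (x - y) + b) * (norm (x - y) + a)"
    using assms by (intro mult_pos_pos add_nonneg_pos) auto
qed simp

lemma gL_quotient_tendsto: "(gL_quotient f \<longlongrightarrow> gL_norm f) at_top"
proof -
  have "(gL_quotient f \<longlongrightarrow> (INF a\<in>{0<..}. gL_quotient f a)) at_top"
  proof (rule order_tendstoI)
    fix c assume "c < (INF a\<in>{0<..}. gL_quotient f a)"
    then have "c < gL_quotient f a" if "0 < a" for a
      using that by (auto intro: less_le_trans INF_lower)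
    then show "\<forall>\<^sub>F a in at_top. c < gL_quotient f a"
      by (intro eventually_mono[OF eventually_gt_at_top[of "0::real"]])
  next
    fix c assume "(INF a\<in>{0<..}. gL_quotient f a) < c"
    then obtain a where a: "0 < a" "gL_quotient f a < c"
      by (auto simp: INF_less_iff)
    show "\<forall>\<^sub>F b in at_top. gL_quotient f b < c"
      using eventually_ge_at_top[of a]
      by (rule eventually_mono) (use a gL_quotient_antimono le_less_trans in blast)
  qed
  then show ?thesis
    unfolding gL_norm_def using tendsto_Lim trivial_limit_at_top_linorder by metis
qed

definition plant_class :: "real \<Rightarrow> (real ^ 'd \<Rightarrow> real ^ 'd) set" where
  "plant_class L = {f. gL_norm f \<le> ennreal L}"

definition kappa :: "nat \<Rightarrow> real" where
  "kappa d = exp (integral {0..1/2} (\<lambda>t. t ^ (d - 1) / (1 - t\<^sup>2)))"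

text \<open>
  At time \<open>t\<close> the law receives \<open>[x\<^sub>0, \<dots>, x\<^sub>t]\<close> and \<open>[u\<^sub>0, \<dots>, u\<^sub>t\<^sub>-\<^sub>1]\<close>, and nothing else, so causality
  is built into the type; only lists of lengths \<open>t + 1\<close> and \<open>t\<close> are ever supplied.
\<close>

type_synonym 'd feedback = "nat \<Rightarrow> (real ^ 'd) list \<Rightarrow> (real ^ 'd) list \<Rightarrow> real ^ 'd"

text \<open>Histories of states and controls known when the control at time \<open>t\<close> is chosen;
  \<open>w 0\<close> is never used.\<close>

primrec closed_loop_history ::
  "'d feedback \<Rightarrow> (real ^ 'd \<Rightarrow> real ^ 'd) \<Rightarrow> (nat \<Rightarrow> real ^ 'd) \<Rightarrow> real ^ 'd
    \<Rightarrow> nat \<Rightarrow> (real ^ 'd) list \<times> (real ^ 'd) list" where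
  "closed_loop_history \<Sigma> f w x0 0 = ([x0], [])"
| "closed_loop_history \<Sigma> f w x0 (Suc t) =
    (let (xs, us) = closed_loop_history \<Sigma> f w x0 t;
         u = \<Sigma> t xs us
     in (xs @ [f (last xs) + u + w (Suc t)], us @ [u]))"

definition closed_loop_state ::
  "'d feedback \<Rightarrow> (real ^ 'd \<Rightarrow> real ^ 'd) \<Rightarrow> (nat \<Rightarrow> real ^ 'd) \<Rightarrow> real ^ 'd \<Rightarrow> nat \<Rightarrow> real ^ 'd" where
  "closed_loop_state \<Sigma> f w x0 t = last (fst (closed_loop_history \<Sigma> f w x0 t))"

definition closed_loop_control ::
  "'d feedback \<Rightarrow> (real ^ 'd \<Rightarrow> real ^ 'd) \<Rightarrow> (nat \<Rightarrow> real ^ 'd) \<Rightarrow> real ^ 'd \<Rightarrow> nat \<Rightarrow> real ^ 'd" where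
  "closed_loop_control \<Sigma> f w x0 t = case_prod (\<Sigma> t) (closed_loop_history \<Sigma> f w x0 t)"

lemma closed_loop_history_eq:
  "closed_loop_history \<Sigma> f w x0 t =
    (map (closed_loop_state \<Sigma> f w x0) [0..<Suc t], map (closed_loop_control \<Sigma> f w x0) [0..<t])"
proof (induction t)
  case 0
  show ?case by (simp add: closed_loop_state_def)
next
  case (Suc t)
  let ?h = "closed_loop_history \<Sigma> f w x0"
  have "?h (Suc t) = (fst (?h t) @ [closed_loop_state \<Sigma> f w x0 (Suc t)],
                      snd (?h t) @ [closed_loop_control \<Sigma> f w x0 t])"
    by (simp add: closed_loop_state_def closed_loop_control_def Let_def split: prod.split)
  then show ?case
    using Suc.IH by simp
qed

lemma closed_loop_equations:
  fixes \<Sigma> :: "'d::finite feedback" and f :: "real ^ 'd \<Rightarrow> real ^ 'd"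
    and w :: "nat \<Rightarrow> real ^ 'd" and x0 :: "real ^ 'd"
  defines "x \<equiv> closed_loop_state \<Sigma> f w x0" and "u \<equiv> closed_loop_control \<Sigma> f w x0"
  shows "x 0 = x0"
    and "u t = \<Sigma> t (map x [0..<Suc t]) (map u [0..<t])"
    and "x (Suc t) = f (x t) + u t + w (Suc t)"
proof -
  show "x 0 = x0" by (simp add: x_def closed_loop_state_def)
  show "u t = \<Sigma> t (map x [0..<Suc t]) (map u [0..<t])"
    unfolding x_def u_def
    by (subst closed_loop_control_def) (simp add: closed_loop_history_eq del: upt_Suc)
  show "x (Suc t) = f (x t) + u t + w (Suc t)"
    unfolding x_def u_def
    by (simp add: closed_loop_state_def closed_loop_control_def Let_def split: prod.split)
qed

text \<open>The response \<open>r\<^sub>i = x\<^sub>i\<^sub>+\<^sub>1 - u\<^sub>i\<close>, computed from the recorded histories.\<close>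

definition response :: "(real ^ 'd) list \<Rightarrow> (real ^ 'd) list \<Rightarrow> nat \<Rightarrow> real ^ 'd" where
  "response xs us i = xs ! Suc i - us ! i"

definition is_nearest :: "nat \<Rightarrow> (real ^ 'd) list \<Rightarrow> nat \<Rightarrow> bool" where
  "is_nearest t xs i \<longleftrightarrow> i < t \<and> (\<forall>j<t. norm (xs ! t - xs ! i) \<le> norm (xs ! t - xs ! j))"

text \<open>A nearest-neighbor law cancels the response recorded at a closest earlier state, i.e. it
  uses \<open>r\<^sub>i\<close> as the prediction of the unknown \<open>f x\<^sub>t\<close>.\<close>

definition nearest_neighbor_law :: "'d::finite feedback \<Rightarrow> bool" where
  "nearest_neighbor_law \<Sigma> \<longleftrightarrow>
    (\<forall>t\<ge>1. \<forall>xs us. length xs = Suc t \<longrightarrow> length us = t \<longrightarrow>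
      (\<exists>i. is_nearest t xs i \<and> \<Sigma> t xs us = - response xs us i))"

text \<open>The explicit law: no control at time 0, and ties broken in favour of the earliest time.\<close>

definition nn_feedback :: "'d::finite feedback" where
  "nn_feedback t xs us =
    (if t = 0 then 0 else - response xs us (LEAST i. is_nearest t xs i))"

end

theory Submission
  imports Defs
begin

text \<open>
  Along the closed loop \<open>norm x\<^sub>t\<^sub>+\<^sub>1 \<le> L' * gap\<^sub>t + C\<close>, where \<open>gap\<^sub>t\<close> is the distance of \<open>x\<^sub>t\<close> to the
  earlier states. If the states were unbounded, so would be the gaps; keep only the states
  \<open>y\<^sub>k\<close> at which the gap \<open>\<delta>\<^sub>k\<close> exceeds all gaps since the previous kept state. Then the balls of
  radius \<open>\<delta>\<^sub>k / 2\<close> about the \<open>y\<^sub>k\<close> are disjoint, and up to lower-order terms \<open>\<delta>\<^sub>k \<le> norm y\<^sub>k\<close> and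
  \<open>norm y\<^sub>k\<^sub>+\<^sub>1 \<le> L' * \<delta>\<^sub>k\<close>.

  Measure volume with density \<open>norm y ^ (-d)\<close>, normalised so that the shell between radii \<open>a < b\<close>
  has measure \<open>ln (b / a)\<close>. A ball about \<open>x\<close> of radius \<open>\<rho> * norm x / 2\<close> then has measure (at least)
  \<open>\<integral>\<^sub>0\<^sup>\<rho>\<^sup>/\<^sup>2 t ^ (d - 1) / (1 - t\<^sup>2) dt \<ge> ln \<rho> + ln \<kappa>\<^sub>d\<close>, so each step increases \<open>ln (norm y\<^sub>k)\<close> by at
  most the measure of the \<open>k\<close>-th ball minus the fixed amount \<open>ln (\<kappa>\<^sub>d / L')\<close>. As the first \<open>n\<close> balls
  lie in one shell of measure \<open>ln (norm y\<^sub>n) + O(1)\<close>, the number of steps is bounded.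
\<close>

section \<open>The chord map\<close>

text \<open>The matrix is the identity with \<open>w\<close> added to row \<open>k\<close>. As
  \<open>w $ k = 0\<close>, \<open>w\<close> is a combination of the other rows, and adding such a
  combination preserves the determinant.\<close>

lemma det_shear_row:
  fixes w :: "real ^ 'n"
  assumes "w $ k = 0"
  shows "det (matrix (\<lambda>h. h + (w \<bullet> h) *\<^sub>R axis k 1)) = 1"
proof -
  have "w = (\<Sum>j\<in>UNIV. w $ j *s axis j 1)"
    by (simp add: basis_expansion)
  also have "\<dots> = (\<Sum>j\<in>-{k}. w $ j *s axis j 1)"
    using assms by (intro sum.mono_neutral_right) auto
  also have "\<dots> \<in> vec.span {row j (mat 1 :: real^'n^'n) |j. j \<noteq> k}"
  proof (intro vec.span_sum vec.span_scale vec.span_base)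
    fix j assume "j \<in> -{k}"
    moreover have "axis j 1 = row j (mat 1 :: real^'n^'n)"
      by (auto simp: row_def mat_def axis_def vec_eq_iff)
    ultimately show "axis j 1 \<in> {row j (mat 1 :: real^'n^'n) |j. j \<noteq> k}" by auto
  qed
  finally have w: "w \<in> vec.span {row j (mat 1 :: real^'n^'n) |j. j \<noteq> k}" .
  have "matrix (\<lambda>h. h + (w \<bullet> h) *\<^sub>R axis k 1) =
      (\<chi> i. if i = k then row k (mat 1) + w else row i (mat 1))"
    by (simp add: matrix_def vec_eq_iff row_def mat_def inner_axis) (simp add: axis_def)
  then show ?thesis
    using det_row_span[OF w] by simp
qed

lemma det_shear_column:
  fixes w :: "real ^ 'n"
  assumes "w $ k = 0"
  shows "det (matrix (\<lambda>h. h + h $ k *\<^sub>R w)) = 1"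
proof -
  have "matrix (\<lambda>h. h + h $ k *\<^sub>R w) = transpose (matrix (\<lambda>h. h + (w \<bullet> h) *\<^sub>R axis k 1))"
    by (simp add: matrix_def transpose_def vec_eq_iff inner_axis) (simp add: axis_def)
  then show ?thesis
    using det_shear_row[OF assms] by (simp add: det_transpose)
qed

lemma det_axis_scaling:
  "det (matrix (\<lambda>h :: real ^ 'n. t *\<^sub>R h + ((s - t) * h $ k) *\<^sub>R axis k 1)) = s * t ^ (CARD('n) - 1)"
proof -
  have "det (matrix (\<lambda>h :: real ^ 'n. t *\<^sub>R h + ((s - t) * h $ k) *\<^sub>R axis k 1)) =
      (\<Prod>i\<in>(UNIV :: 'n set). if i = k then s else t)"
    by (subst det_diagonal) (auto simp: matrix_def axis_def intro!: prod.cong)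
  also have "\<dots> = s * (\<Prod>i\<in>UNIV-{k}. if i = k then s else t)"
    by (subst prod.remove[of _ k]) auto
  also have "(\<Prod>i\<in>UNIV-{k}. if i = k then s else t) = (\<Prod>i\<in>UNIV-{k}. t)"
    by (rule prod.cong) auto
  finally show ?thesis by (simp add: card_Diff_singleton)
qed

text \<open>
  The map below evaluates the measure of a ball about the unit vector \<open>e\<close> of axis \<open>k\<close>. It turns each
  chord of the unit ball parallel to \<open>e\<close>, about the centre, into the chord of equal offset lying on a
  line through \<open>- e\<close>, and translates by \<open>e\<close>. So distances to the centre are preserved, while the
  distance to the origin and the Jacobian become explicit in the coordinates of the chord.
\<close>

definition offset :: "'n \<Rightarrow> real ^ 'n \<Rightarrow> real ^ 'n" where
  "offset k z = z - z $ k *\<^sub>R axis k 1"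

definition half_chord :: "'n \<Rightarrow> real ^ 'n \<Rightarrow> real" where
  "half_chord k z = sqrt (1 - (norm (offset k z))\<^sup>2)"

definition chord_map :: "'n \<Rightarrow> real ^ 'n \<Rightarrow> real ^ 'n" where
  "chord_map k z = (half_chord k z + z $ k) *\<^sub>R (half_chord k z *\<^sub>R axis k 1 + offset k z)"

text \<open>The product rule applied to \<open>chord_map\<close>; \<open>c'\<close> is the
  derivative of \<open>half_chord k\<close> at \<open>z\<close> in direction
  \<open>h\<close>.\<close>

definition chord_map' :: "'n \<Rightarrow> real ^ 'n \<Rightarrow> real ^ 'n \<Rightarrow> real ^ 'n" where
  "chord_map' k z h =
    (let c' = - (offset k z \<bullet> h) / half_chord k z in
      (c' + h $ k) *\<^sub>R (half_chord k z *\<^sub>R axis k 1 + offset k z) +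
      (half_chord k z + z $ k) *\<^sub>R (c' *\<^sub>R axis k 1 + offset k h))"

lemma offset_nth [simp]: "offset k z $ k = 0"
  by (simp add: offset_def)

lemma offset_inner_axis [simp]: "offset k z \<bullet> axis k 1 = 0" "axis k 1 \<bullet> offset k z = 0"
  by (simp_all add: inner_axis inner_axis')

lemma norm_eq_offset: "(norm z)\<^sup>2 = (norm (offset k z))\<^sup>2 + (z $ k)\<^sup>2"
proof -
  have "z = offset k z + z $ k *\<^sub>R axis k 1" by (simp add: offset_def)
  then have "z \<bullet> z = (offset k z + z $ k *\<^sub>R axis k 1) \<bullet> (offset k z + z $ k *\<^sub>R axis k 1)" by simp
  also have "\<dots> = offset k z \<bullet> offset k z + z $ k * z $ k"
    by (simp add: inner_add_left inner_add_right inner_axis_axis)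
  finally show ?thesis unfolding power2_norm_eq_inner by (simp add: power2_eq_square)
qed

text \<open>All parts come from Pythagoras (\<open>norm_eq_offset\<close>). The last one is what
  later makes the symmetrised density radial.\<close>

lemma half_chord_bounds:
  assumes "norm z < 1"
  shows "half_chord k z > 0" "\<bar>z $ k\<bar> < half_chord k z"
    "(half_chord k z)\<^sup>2 = 1 - (norm (offset k z))\<^sup>2"
    "(half_chord k z)\<^sup>2 - (z $ k)\<^sup>2 = 1 - (norm z)\<^sup>2"
proof -
  have "(norm z)\<^sup>2 < 1" using assms by (simp add: power_less_one_iff abs_square_less_1)
  then have *: "(norm (offset k z))\<^sup>2 + (z $ k)\<^sup>2 < 1" using norm_eq_offset[of z k] by simp
  then have **: "1 - (norm (offset k z))\<^sup>2 > 0" using zero_le_power2[of "z $ k"] by linarith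
  then show "half_chord k z > 0" by (simp add: half_chord_def)
  show "(half_chord k z)\<^sup>2 = 1 - (norm (offset k z))\<^sup>2" using ** by (simp add: half_chord_def)
  then show "(half_chord k z)\<^sup>2 - (z $ k)\<^sup>2 = 1 - (norm z)\<^sup>2" using norm_eq_offset[of z k] by simp
  show "\<bar>z $ k\<bar> < half_chord k z" unfolding half_chord_def
    by (rule real_less_rsqrt) (use * in simp)
qed

lemma chord_map_has_derivative:
  assumes "norm z < 1"
  shows "(chord_map k has_derivative chord_map' k z) (at z within S)"
proof -
  have off: "(offset k has_derivative offset k) (at z within S)"
    by (rule linear_imp_has_derivative) (auto intro!: linearI simp: offset_def algebra_simps)
  \<comment> \<open>The radicand stays positive inside the unit ball, so the square root is
    differentiable there.\<close>
  have pos: "1 - (norm (offset k z))\<^sup>2 > 0"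
    using half_chord_bounds[OF assms, of k] zero_less_power2[of "half_chord k z"] by simp
  have io: "offset k z \<bullet> offset k h = offset k z \<bullet> h" for h
    by (simp add: offset_def[of k h] inner_diff_right)
  have "((\<lambda>z. 1 - offset k z \<bullet> offset k z) has_derivative
      (\<lambda>h. 0 - (offset k z \<bullet> offset k h + offset k h \<bullet> offset k z))) (at z within S)"
    by (intro has_derivative_diff has_derivative_const has_derivative_inner off)
  then have "((\<lambda>z. 1 - offset k z \<bullet> offset k z) has_derivative (\<lambda>h. - 2 * (offset k z \<bullet> h))) (at z within S)"
    by (rule has_derivative_eq_rhs) (simp add: fun_eq_iff io inner_commute[of "offset k _" "offset k z"])
  then have "((\<lambda>z. sqrt (1 - offset k z \<bullet> offset k z)) has_derivative
      (\<lambda>h. - 2 * (offset k z \<bullet> h) * (inverse (sqrt (1 - offset k z \<bullet> offset k z)) / 2))) (at z within S)"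
    using pos by (intro has_derivative_real_sqrt) (simp_all add: power2_norm_eq_inner)
  then have hc: "(half_chord k has_derivative (\<lambda>h. - (offset k z \<bullet> h) / half_chord k z)) (at z within S)"
    unfolding half_chord_def[abs_def] power2_norm_eq_inner
    by (rule has_derivative_eq_rhs) (simp add: fun_eq_iff field_simps)
  have nth: "((\<lambda>z. z $ k) has_derivative (\<lambda>z. z $ k)) (at z within S)"
    by (rule bounded_linear_imp_has_derivative[OF bounded_linear_vec_nth])
  show ?thesis
    unfolding chord_map_def[abs_def]
  proof (rule has_derivative_eq_rhs)
    show "((\<lambda>z. (half_chord k z + z $ k) *\<^sub>R (half_chord k z *\<^sub>R axis k 1 + offset k z)) has_derivative
      (\<lambda>h. (half_chord k z + z $ k) *\<^sub>R ((- (offset k z \<bullet> h) / half_chord k z) *\<^sub>R axis k 1 + offset k h) +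
        (- (offset k z \<bullet> h) / half_chord k z + h $ k) *\<^sub>R (half_chord k z *\<^sub>R axis k 1 + offset k z)))
      (at z within S)"
      by (intro has_derivative_scaleR has_derivative_add has_derivative_scaleR_left hc off nth)
  qed (simp add: chord_map'_def Let_def fun_eq_iff)
qed

text \<open>Polar coordinates about the origin: \<open>half_chord k z + z $ k\<close> is the radius,
  which contributes its power \<open>CARD('n) - 1\<close>, and \<open>1 / half_chord k z\<close> is
  the area density of the unit sphere over its projection along axis \<open>k\<close>.\<close>

lemma det_chord_map':
  fixes z :: "real ^ 'n"
  assumes "norm z < 1"
  shows "det (matrix (chord_map' k z)) = (half_chord k z + z $ k) ^ (CARD('n) - 1) / half_chord k z"
proof -
  define c t u where "c = half_chord k z" and "t = c + z $ k" and "u = offset k z"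
  have c: "c > 0" "c\<^sup>2 = 1 - u \<bullet> u"
    using half_chord_bounds[OF assms] by (auto simp: c_def u_def power2_norm_eq_inner)
  \<comment> \<open>The derivative factors as \<open>A \<circ> B \<circ> D \<circ> A\<close> into two kinds of shears and an axis scaling.\<close>
  define A where "A = (\<lambda>h. h + ((- u /\<^sub>R c) \<bullet> h) *\<^sub>R axis k (1::real))"
  define D where "D = (\<lambda>h :: real^'n. t *\<^sub>R h + ((1 / c - t) * h $ k) *\<^sub>R axis k 1)"
  define B where "B = (\<lambda>h. h + h $ k *\<^sub>R (c *\<^sub>R u))"
  have lin: "linear A" "linear D" "linear B"
    by (auto intro!: linearI simp: A_def D_def B_def algebra_simps inner_add_right add_divide_distrib)
  have u: "u $ k = 0" "u \<bullet> axis k 1 = 0" by (simp_all add: u_def)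
  have "A (B (D (A h))) = chord_map' k z h" for h
  proof -
    \<comment> \<open>This is the sphere equation for \<open>(c, u)\<close>. It lets the last shear
      turn the axis coefficient \<open>1 / c\<close> into \<open>c\<close>.\<close>
    have inv: "1 / c = c + (u \<bullet> u) / c"
      using c by (simp add: field_simps power2_eq_square)
    define a where "a = - (u \<bullet> h) / c"
    have Ah: "A h = h + a *\<^sub>R axis k 1" by (simp add: A_def a_def divide_inverse mult.commute)
    have "D (A h) $ k = (h $ k + a) / c" by (simp add: Ah D_def algebra_simps)
    then have "B (D (A h)) = D (A h) + (h $ k + a) *\<^sub>R u" using c(1) by (simp add: B_def)
    also have "\<dots> = t *\<^sub>R (h + a *\<^sub>R axis k 1) + ((1 / c - t) * (h $ k + a)) *\<^sub>R axis k 1 + (h $ k + a) *\<^sub>R u"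
      by (simp add: Ah D_def)
    also have "\<dots> = t *\<^sub>R offset k h + ((h $ k + a) / c) *\<^sub>R axis k 1 + (h $ k + a) *\<^sub>R u" (is "_ = ?v")
      by (simp add: offset_def algebra_simps add_divide_distrib)
    finally have BDA: "B (D (A h)) = ?v" .
    have uh: "u \<bullet> offset k h = - (c * a)"
      using c(1) u by (simp add: offset_def inner_diff_right a_def)
    have "(- u /\<^sub>R c) \<bullet> ?v = t * a - (h $ k + a) * ((u \<bullet> u) / c)"
      using c(1) by (simp add: inner_add_right uh u field_simps)
    then have "A ?v = ?v + (t * a - (h $ k + a) * ((u \<bullet> u) / c)) *\<^sub>R axis k 1"
      by (simp only: A_def)
    also have "\<dots> = t *\<^sub>R offset k h + (t * a + (h $ k + a) * (1 / c - (u \<bullet> u) / c)) *\<^sub>R axis k 1 + (h $ k + a) *\<^sub>R u"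
      by (simp add: algebra_simps add_divide_distrib diff_divide_distrib)
    also have "1 / c - (u \<bullet> u) / c = c" using inv by simp
    finally show ?thesis unfolding BDA chord_map'_def Let_def c_def[symmetric] u_def[symmetric] a_def[symmetric] t_def[symmetric]
      by (simp add: scaleR_add_right scaleR_add_left mult.commute)
  qed
  then have "chord_map' k z = A \<circ> (B \<circ> (D \<circ> A))" by (auto simp: fun_eq_iff)
  then have "matrix (chord_map' k z) = matrix A ** (matrix B ** (matrix D ** matrix A))"
    using lin by (simp add: matrix_compose linear_compose)
  moreover have "det (matrix A) = 1" unfolding A_def by (rule det_shear_row) (simp add: u)
  moreover have "det (matrix B) = 1" unfolding B_def by (rule det_shear_column) (simp add: u)
  moreover have "det (matrix D) = 1 / c * t ^ (CARD('n) - 1)" unfolding D_def by (rule det_axis_scaling)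
  ultimately show ?thesis by (simp add: det_mul c_def t_def)
qed

text \<open>With \<open>c = half_chord k z\<close> and \<open>t = c + z $ k\<close>, the image is
  \<open>t\<close> times a unit vector whose axis component is \<open>c\<close>. Its squared
  distance to \<open>axis k 1\<close> is therefore
  \<open>t^2 - 2 * t * c + 1 = 1 - c^2 + (z $ k)^2\<close>.\<close>

lemma norm_chord_map:
  assumes "norm z < 1"
  shows "norm (chord_map k z) = half_chord k z + z $ k"
    "norm (chord_map k z - axis k 1) = norm z"
proof -
  define c u where "c = half_chord k z" and "u = offset k z"
  have c: "c > 0" "u \<bullet> u = 1 - c\<^sup>2" "c + z $ k > 0" and z: "z \<bullet> z = 1 - c\<^sup>2 + (z $ k)\<^sup>2"
    using half_chord_bounds[OF assms, of k] by (auto simp: c_def u_def power2_norm_eq_inner)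
  have u: "u \<bullet> axis k 1 = 0" "axis k 1 \<bullet> u = 0" "axis k (1::real) \<bullet> axis k 1 = 1"
    by (simp_all add: u_def inner_axis_axis)
  have v: "(norm (c *\<^sub>R axis k 1 + u))\<^sup>2 = 1"
    unfolding power2_norm_eq_inner by (simp add: inner_add_left inner_add_right u c power2_eq_square)
  then have v1: "norm (c *\<^sub>R axis k 1 + u) = 1" by (simp add: power2_eq_1_iff) (smt (verit) norm_ge_zero)
  then show "norm (chord_map k z) = half_chord k z + z $ k"
    using c by (simp add: chord_map_def c_def u_def)
  have "(norm (chord_map k z - axis k 1))\<^sup>2 = (c + z $ k)\<^sup>2 - 2 * (c + z $ k) * c + 1"
  proof -
    have "(norm (chord_map k z - axis k 1))\<^sup>2 =
      (c + z $ k)\<^sup>2 * (norm (c *\<^sub>R axis k 1 + u))\<^sup>2 - 2 * (c + z $ k) * c + 1"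
      unfolding chord_map_def c_def[symmetric] u_def[symmetric] power2_norm_eq_inner
      by (simp add: inner_diff_left inner_diff_right inner_add_left inner_add_right u) (simp add: algebra_simps power2_eq_square)
    then show ?thesis using v by simp
  qed
  also have "\<dots> = (norm z)\<^sup>2" unfolding power2_norm_eq_inner z by (simp add: power2_eq_square algebra_simps)
  finally show "norm (chord_map k z - axis k 1) = norm z"
    using power2_eq_imp_eq[OF _ norm_ge_zero norm_ge_zero] by blast
qed

text \<open>The norm of the image recovers the radius; dividing by it recovers the direction, whose
  components are \<open>half_chord\<close> and \<open>offset\<close>, and these determine the
  point.\<close>

lemma inj_on_chord_map: "inj_on (chord_map k) (ball 0 1)"
proof (rule inj_onI)
  fix x y assume "x \<in> ball 0 1" "y \<in> ball 0 1" and eq: "chord_map k x = chord_map k y"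
  then have xy: "norm x < 1" "norm y < 1" by auto
  have t: "half_chord k x + x $ k = half_chord k y + y $ k"
    using norm_chord_map(1)[OF xy(1)] norm_chord_map(1)[OF xy(2)] eq by metis
  moreover have "half_chord k x + x $ k > 0" using half_chord_bounds[OF xy(1), of k] by linarith
  ultimately have v: "half_chord k x *\<^sub>R axis k 1 + offset k x = half_chord k y *\<^sub>R axis k 1 + offset k y"
    using eq by (simp add: chord_map_def)
  have "(half_chord k x *\<^sub>R axis k 1 + offset k x) $ k = (half_chord k y *\<^sub>R axis k 1 + offset k y) $ k" using v by simp
  then have "half_chord k x = half_chord k y" by simp
  with t v have "x $ k = y $ k" "offset k x = offset k y" by auto
  then show "x = y" by (simp add: offset_def)
qed

section \<open>The logarithmic measure\<close>

text \<open>Both measures give \<open>{..a}\<close> the volume of the ball of radius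
  \<open>a\<close>, and these half-lines form an intersection-stable generator of the Borel
  sets.\<close>

lemma distr_lborel_norm:
  fixes d :: nat and c :: real
  defines "d \<equiv> DIM('a :: euclidean_space)"
  defines "c \<equiv> real d * unit_ball_vol d"
  shows "distr (lborel :: 'a measure) borel norm =
    density lborel (\<lambda>s. ennreal (c * s ^ (d - 1)) * indicator {0..} s)" (is "?M = ?N")
proof (rule measure_eqI_generator_eq[where E = "range atMost" and \<Omega> = UNIV and A = "\<lambda>n. {..real n}"])
  have d: "d > 0" by (simp add: d_def)
  have c: "c \<ge> 0" by (simp add: c_def)
  have M: "emeasure ?M {..a} = (if a < 0 then 0 else ennreal (unit_ball_vol d * a ^ d))" for a
  proof -
    have "emeasure ?M {..a} = emeasure lborel {x :: 'a. norm x \<le> a}"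
      by (subst emeasure_distr) (auto simp: vimage_def)
    also have "{x :: 'a. norm x \<le> a} = cball 0 a" by auto
    finally show ?thesis by (auto simp: emeasure_cball d_def)
  qed
  have N: "emeasure ?N {..a} = (if a < 0 then 0 else ennreal (unit_ball_vol d * a ^ d))" for a
  proof -
    have "emeasure ?N {..a} = (\<integral>\<^sup>+s. ennreal (c * s ^ (d - 1)) * indicator {0..a} s \<partial>lborel)"
      by (subst emeasure_density) (auto intro!: nn_integral_cong simp: indicator_def)
    also have "\<dots> = (if a < 0 then 0 else ennreal (unit_ball_vol d * a ^ d))"
    proof (cases "a < 0")
      case False
      have "(\<integral>\<^sup>+s. ennreal (c * s ^ (d - 1)) * indicator {0..a} s \<partial>lborel) =
          ennreal (unit_ball_vol d * a ^ d - unit_ball_vol d * 0 ^ d)"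
        using False c by (intro nn_integral_FTC_Icc) (auto intro!: derivative_eq_intros simp: c_def)
      then show ?thesis using False d by (simp add: zero_power)
    qed (simp add: indicator_def)
    finally show ?thesis .
  qed
  show "emeasure ?M X = emeasure ?N X" if "X \<in> range atMost" for X
    using that M N by auto
  show "emeasure ?M {..real n} \<noteq> \<infinity>" for n
    using M[of "real n"] by simp
  show "Int_stable (range (atMost :: real \<Rightarrow> _))"
    by (auto simp: Int_stable_def)
  show "(\<Union>n. {..real n}) = UNIV" by (auto simp: real_arch_simple)
qed (auto simp: borel_eq_atMost[where 'a = real])

lemma nn_integral_lborel_norm:
  fixes F :: "real \<Rightarrow> ennreal"
  assumes [measurable]: "F \<in> borel_measurable borel"
  shows "(\<integral>\<^sup>+z. F (norm z) \<partial>(lborel :: 'a :: euclidean_space measure)) =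
    (\<integral>\<^sup>+s. F s * ennreal (DIM('a) * unit_ball_vol DIM('a) * s ^ (DIM('a) - 1)) * indicator {0..} s \<partial>lborel)"
proof -
  have "(\<integral>\<^sup>+z. F (norm z) \<partial>(lborel :: 'a :: euclidean_space measure)) =
      (\<integral>\<^sup>+s. F s \<partial>distr (lborel :: 'a measure) borel norm)"
    by (subst nn_integral_distr) auto
  then show ?thesis
    unfolding distr_lborel_norm by (simp add: nn_integral_density mult_ac)
qed

text \<open>\<open>DIM('a) * unit_ball_vol DIM('a)\<close> is the area of the unit sphere, so the
  radial part of the measure is \<open>ds / s\<close>, which is invariant under scaling. At the
  origin the value is 0, by division by zero.\<close>

definition log_density :: "'a :: euclidean_space \<Rightarrow> real" where
  "log_density y = 1 / (DIM('a) * unit_ball_vol DIM('a) * norm y ^ DIM('a))"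

definition log_measure :: "'a :: euclidean_space measure" where
  "log_measure = density lborel (\<lambda>y. ennreal (log_density y))"

lemma sets_log_measure [simp, measurable_cong]: "sets log_measure = sets borel"
  by (simp add: log_measure_def)

lemma borel_measurable_log_density [measurable]: "log_density \<in> borel_measurable borel"
  unfolding log_density_def[abs_def] by measurable

lemma emeasure_log_measure_annulus:
  assumes "0 < a" "a \<le> b"
  shows "emeasure log_measure {y :: 'a :: euclidean_space. a \<le> norm y \<and> norm y \<le> b} = ennreal (ln (b / a))"
proof -
  define d where "d = DIM('a)"
  define c where "c = real d * unit_ball_vol d"
  have c: "c > 0" by (simp add: c_def d_def)
  have d: "d > 0" by (simp add: d_def)
  define F where "F = (\<lambda>s. ennreal (1 / (c * s ^ d)) * indicator {a..b} s)"
  have [measurable]: "F \<in> borel_measurable borel" by (simp add: F_def)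
  have meas: "{y :: 'a. a \<le> norm y \<and> norm y \<le> b} \<in> sets borel" by measurable
  have "emeasure log_measure {y :: 'a. a \<le> norm y \<and> norm y \<le> b} = (\<integral>\<^sup>+y. F (norm (y :: 'a)) \<partial>lborel)"
    unfolding log_measure_def using meas
    by (subst emeasure_density)
       (auto intro!: nn_integral_cong simp: F_def log_density_def c_def d_def indicator_def)
  also have "\<dots> = (\<integral>\<^sup>+s. F s * ennreal (c * s ^ (d - 1)) * indicator {0..} s \<partial>lborel)"
    unfolding c_def d_def by (rule nn_integral_lborel_norm) measurable
  also have "\<dots> = (\<integral>\<^sup>+s. ennreal (1 / s) * indicator {a..b} s \<partial>lborel)"
  proof (rule nn_integral_cong)
    fix s
    show "F s * ennreal (c * s ^ (d - 1)) * indicator {0..} s = ennreal (1 / s) * indicator {a..b} s"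
    proof (cases "s \<in> {a..b}")
      case True
      then have s: "s > 0" using assms by auto
      have "1 / (c * s ^ d) * (c * s ^ (d - 1)) = 1 / s"
        using s c d by (cases d) (auto simp: field_simps)
      then show ?thesis using True s c unfolding F_def
        by (simp add: ennreal_mult[symmetric])
    qed (simp add: F_def)
  qed
  also have "\<dots> = ennreal (ln b - ln a)"
    using assms by (intro nn_integral_FTC_Icc) (auto intro!: derivative_eq_intros)
  finally show ?thesis using assms by (simp add: ln_div)
qed

section \<open>Logarithmic measure of balls\<close>

lemma nn_integral_lborel_reflect:
  fixes F :: "'a :: euclidean_space \<Rightarrow> ennreal"
  assumes [measurable]: "F \<in> borel_measurable borel"
  shows "(\<integral>\<^sup>+z. F (- z) \<partial>lborel) = (\<integral>\<^sup>+z. F z \<partial>lborel)"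
proof -
  have "(lborel :: 'a measure) = distr lborel borel uminus"
    using lborel_affine[of "-1" "0 :: 'a"] by (simp add: density_1)
  then have "(\<integral>\<^sup>+z. F z \<partial>lborel) = (\<integral>\<^sup>+z. F z \<partial>distr lborel borel uminus)" by simp
  also have "\<dots> = (\<integral>\<^sup>+z. F (- z) \<partial>lborel)" by (subst nn_integral_distr) auto
  finally show ?thesis ..
qed

text \<open>Scalars are identified with \<open>real ^ 1\<close> in the theorem for vector-valued
  integrands.\<close>

lemma has_absolute_integral_change_of_variables_real:
  fixes f :: "real ^ 'm :: {finite, wellorder} \<Rightarrow> real" and g :: "real ^ 'm :: _ \<Rightarrow> real ^ 'm :: _"
  assumes "S \<in> sets lebesgue"
    and "\<And>x. x \<in> S \<Longrightarrow> (g has_derivative g' x) (at x within S)"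
    and "inj_on g S"
  shows "(\<lambda>x. \<bar>det (matrix (g' x))\<bar> * f (g x)) absolutely_integrable_on S \<and>
      integral S (\<lambda>x. \<bar>det (matrix (g' x))\<bar> * f (g x)) = b \<longleftrightarrow>
    f absolutely_integrable_on (g ` S) \<and> integral (g ` S) f = b"
  using has_absolute_integral_change_of_variables[OF assms, of "\<lambda>x. vec (f x) :: real ^ 1" "vec b"]
  by (simp add: absolutely_integrable_on_1_iff integral_on_1_eq)

text \<open>A lower bound for the logarithmic measure of a ball of radius \<open>r * norm x\<close>
  about \<open>x\<close>; at \<open>r = 1/2\<close> it equals \<open>ln (kappa d)\<close>.\<close>

definition ball_bound :: "nat \<Rightarrow> real \<Rightarrow> real" where
  "ball_bound d r = integral {0..r} (\<lambda>t. t ^ (d - 1) / (1 - t\<^sup>2))"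

lemma continuous_on_ball_bound_integrand:
  fixes r :: real
  assumes "r < 1"
  shows "continuous_on {0..r} (\<lambda>t. t ^ n / (1 - t\<^sup>2))"
proof (intro continuous_intros ballI)
  fix t assume "t \<in> {0..r}"
  then have "t\<^sup>2 < 1" using assms by (simp add: abs_square_less_1)
  then show "1 - t\<^sup>2 \<noteq> 0" by simp
qed

text \<open>The integrand is the one that symmetrisation produces in
  \<open>emeasure_log_measure_ball\<close>.\<close>

lemma nn_integral_ball_radial:
  assumes "0 < r" "r < 1"
  shows "(\<integral>\<^sup>+z. ennreal (1 / (DIM('a) * unit_ball_vol DIM('a) * (1 - (norm z)\<^sup>2))) * indicator (ball 0 r) z
      \<partial>(lborel :: 'a :: euclidean_space measure)) = ennreal (ball_bound DIM('a) r)"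
proof -
  define d where "d = DIM('a)"
  define c where "c = real d * unit_ball_vol d"
  have c: "c > 0" by (simp add: c_def d_def)
  define F where "F = (\<lambda>s. ennreal (1 / (c * (1 - s\<^sup>2))) * indicator {..<r} s)"
  have [measurable]: "F \<in> borel_measurable borel" by (simp add: F_def)
  have "(\<integral>\<^sup>+z. ennreal (1 / (c * (1 - (norm z)\<^sup>2))) * indicator (ball 0 r) z \<partial>(lborel :: 'a measure)) =
     (\<integral>\<^sup>+z. F (norm z) \<partial>(lborel :: 'a measure))"
    by (auto intro!: nn_integral_cong simp: F_def indicator_def)
  also have "\<dots> = (\<integral>\<^sup>+s. F s * ennreal (c * s ^ (d - 1)) * indicator {0..} s \<partial>lborel)"
    unfolding c_def d_def by (rule nn_integral_lborel_norm) measurable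
  also have "\<dots> = (\<integral>\<^sup>+s. ennreal (s ^ (d - 1) / (1 - s\<^sup>2)) * indicator {0..r} s \<partial>lborel)"
  \<comment> \<open>The open ball gives \<open>{..<r}\<close> and the target has
    \<open>{0..r}\<close>; they differ only at the null point \<open>r\<close>.\<close>
  proof (rule nn_integral_cong_AE, rule AE_mp[OF AE_lborel_singleton[of r]], rule AE_I2, rule impI)
    fix s assume "s \<noteq> r"
    show "F s * ennreal (c * s ^ (d - 1)) * indicator {0..} s =
        ennreal (s ^ (d - 1) / (1 - s\<^sup>2)) * indicator {0..r} s"
    proof (cases "s \<in> {0..r}")
      case True
      then have "s\<^sup>2 < 1" using assms by (simp add: abs_square_less_1)
      then have "1 / (c * (1 - s\<^sup>2)) * (c * s ^ (d - 1)) = s ^ (d - 1) / (1 - s\<^sup>2)" "1 - s\<^sup>2 > 0"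
        using c by auto
      then show ?thesis using True \<open>s \<noteq> r\<close> c unfolding F_def
        by (simp add: ennreal_mult[symmetric])
    qed (auto simp: F_def indicator_def)
  qed
  also have "\<dots> = ennreal (ball_bound d r)"
    unfolding ball_bound_def
  proof (rule nn_integral_has_integral_lebesgue')
    fix s assume s: "s \<in> {0..r}"
    then have "s\<^sup>2 < 1" using assms by (simp add: abs_square_less_1)
    then show "0 \<le> s ^ (d - 1) / (1 - s\<^sup>2)" using s by simp
  next
    show "((\<lambda>s. s ^ (d - 1) / (1 - s\<^sup>2)) has_integral integral {0..r} (\<lambda>t. t ^ (d - 1) / (1 - t\<^sup>2))) {0..r}"
      by (intro integrable_integral integrable_continuous_real continuous_on_ball_bound_integrand assms)
  qed
  finally show ?thesis unfolding c_def d_def .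
qed

text \<open>The chord map, rotated and scaled to \<open>x\<close>, carries the ball of radius
  \<open>r\<close> about 0 injectively into the given ball. The density pulled back along it is
  \<open>J\<close>, whose even part is radial.\<close>

lemma emeasure_log_measure_ball:
  fixes x :: "real ^ 'm :: {finite, wellorder}"
  assumes r: "0 < r" "r < 1" and x: "x \<noteq> 0"
  shows "ennreal (ball_bound CARD('m) r) \<le> emeasure log_measure (ball x (r * norm x))"
proof -
  define d where "d = CARD('m)"
  define c where "c = real d * unit_ball_vol d"
  define k :: 'm where "k = undefined"
  define R where "R = norm x"
  define J where "J = (\<lambda>z. 1 / (c * half_chord k z * (half_chord k z + z $ k)))"
  define S where "S = ball (0 :: real ^ 'm::_) r"
  have d: "d > 0" by (simp add: d_def)
  have c: "c > 0" using d by (simp add: c_def)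
  have R: "R > 0" using x by (simp add: R_def)
  \<comment> \<open>Vectors of equal norm are related by an orthogonal map, here taking the axis to
    the direction of \<open>x\<close>.\<close>
  have "norm (axis k 1 :: real ^ 'm::_) = norm (x /\<^sub>R R)" using x by (simp add: R_def)
  then obtain T :: "real ^ 'm::_ \<Rightarrow> real ^ 'm::_"
    where T: "orthogonal_transformation T" "T (axis k 1) = x /\<^sub>R R"
    by (rule orthogonal_transformation_exists)
  have linT: "linear T" using T(1) orthogonal_transformation_linear by blast
  define G where "G = (\<lambda>z. R *\<^sub>R T (chord_map k z))"
  define G' where "G' = (\<lambda>z h. R *\<^sub>R T (chord_map' k z h))"
  have S1: "norm z < 1" if "z \<in> S" for z using that r by (simp add: S_def)
  have der: "(G has_derivative G' z) (at z within S)" if "z \<in> S" for z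
    unfolding G_def G'_def
    by (intro has_derivative_scaleR_right
        bounded_linear.has_derivative[OF linT[THEN linear_conv_bounded_linear[THEN iffD1]]]
        chord_map_has_derivative S1 that)
  have inj: "inj_on G S"
  proof (rule inj_onI)
    fix y z assume yz: "y \<in> S" "z \<in> S" and "G y = G z"
    then have "T (chord_map k y) = T (chord_map k z)" using R by (simp add: G_def)
    then have "chord_map k y = chord_map k z"
      using orthogonal_transformation_inj[OF T(1)] by (simp add: inj_eq)
    then show "y = z" using inj_on_chord_map[of k] S1 yz by (auto dest: inj_onD)
  qed
  have image: "G ` S \<subseteq> ball x (r * norm x)"
  proof
    fix y assume "y \<in> G ` S"
    then obtain z where z: "z \<in> S" "y = G z" by auto
    have "y - x = R *\<^sub>R T (chord_map k z - axis k 1)"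
      using R T(2) by (simp add: z G_def linear_diff[OF linT] algebra_simps)
    then have "norm (y - x) = R * norm z"
      using norm_chord_map(2)[OF S1[OF z(1)], of k] R T(1) by (simp add: orthogonal_transformation_norm)
    then show "y \<in> ball x (r * norm x)"
      using z(1) R by (simp add: S_def dist_norm norm_minus_commute R_def)
  qed
  \<comment> \<open>The powers of \<open>R\<close> cancel by scale invariance, and
    \<open>t ^ (d - 1)\<close> against \<open>t ^ d\<close> leaves \<open>1 / t\<close>.\<close>
  have integrand: "\<bar>det (matrix (G' z))\<bar> * log_density (G z) = J z" if "z \<in> S" for z
  proof -
    have h: "half_chord k z > 0" "half_chord k z + z $ k > 0"
      using half_chord_bounds[OF S1[OF that], of k] by auto
    define t where "t = half_chord k z + z $ k"
    have lin: "linear (chord_map' k z)"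
      using chord_map_has_derivative[OF S1[OF that], of k UNIV] has_derivative_linear by blast
    have "G' z = (*\<^sub>R) R \<circ> (T \<circ> chord_map' k z)" by (auto simp: G'_def)
    then have "det (matrix (G' z)) = R ^ d * (det (matrix T) * det (matrix (chord_map' k z)))"
      using lin linT by (simp add: matrix_compose linear_compose linear_scaleR det_mul d_def)
    then have "\<bar>det (matrix (G' z))\<bar> = R ^ d * t ^ (d - 1) / half_chord k z"
      using R h T(1) by (simp add: abs_mult det_chord_map'[OF S1[OF that]] d_def t_def)
    moreover have "norm (G z) = R * t"
      using R T(1) norm_chord_map(1)[OF S1[OF that], of k]
      by (simp add: G_def orthogonal_transformation_norm t_def)
    moreover have "R ^ d * t ^ (d - 1) / half_chord k z * (1 / (c * (R * t) ^ d)) = 1 / (c * half_chord k z * t)"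
      using R h c d unfolding t_def[symmetric] by (cases d) (auto simp: field_simps)
    ultimately show ?thesis by (simp add: log_density_def J_def c_def d_def t_def)
  qed
  have pos: "half_chord k z > 0" "half_chord k z + z $ k > 0" if "norm z < 1" for z
    using half_chord_bounds[OF that, of k] by auto
  have J_pos: "J z > 0" if "norm z < 1" for z
    using pos[OF that] c by (simp add: J_def)
  have [measurable]: "J \<in> borel_measurable borel"
    unfolding J_def half_chord_def[abs_def] offset_def by measurable
  have J_int: "J absolutely_integrable_on S"
  \<comment> \<open>Since \<open>r < 1\<close>, \<open>J\<close> is continuous on the closed ball,
    which is compact.\<close>
  proof (rule set_integrable_subset)
    have "continuous_on (cball 0 r) J"
      unfolding J_def using c
    proof (intro continuous_intros ballI)
      fix z :: "real ^ 'm::_" assume "z \<in> cball 0 r"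
      then have "norm z < 1" using r by simp
      then show "c * half_chord k z * (half_chord k z + z $ k) \<noteq> 0"
        using pos[of z] c by auto
    qed (auto simp: half_chord_def[abs_def] offset_def intro!: continuous_intros)
    then have "integrable lborel (\<lambda>z. indicator (cball 0 r) z *\<^sub>R J z)"
      by (intro borel_integrable_compact) auto
    then show "J absolutely_integrable_on cball 0 r"
      unfolding set_integrable_def by (subst integrable_completion) auto
    show "S \<in> sets lebesgue" "S \<subseteq> cball 0 r" by (auto simp: S_def)
  qed
  define I where "I = integral S J"
  have "(\<lambda>z. \<bar>det (matrix (G' z))\<bar> * log_density (G z)) absolutely_integrable_on S \<longleftrightarrow>
      J absolutely_integrable_on S"
    by (rule set_integrable_cong) (simp_all add: integrand)
  moreover have "integral S (\<lambda>z. \<bar>det (matrix (G' z))\<bar> * log_density (G z)) = I"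
    unfolding I_def by (rule integral_cong) (rule integrand)
  moreover have "S \<in> sets lebesgue" by (simp add: S_def)
  ultimately have "log_density absolutely_integrable_on (G ` S) \<and> integral (G ` S) log_density = I"
    using has_absolute_integral_change_of_variables_real[OF _ der inj, of log_density I] J_int by blast
  then have "(log_density has_integral I) (G ` S)"
    by (auto simp: has_integral_iff set_lebesgue_integral_eq_integral)
  then have "ennreal I = (\<integral>\<^sup>+y. ennreal (log_density y) * indicator (G ` S) y \<partial>lborel)"
    by (subst nn_integral_has_integral_lebesgue') (auto simp: log_density_def)
  also have "\<dots> \<le> (\<integral>\<^sup>+y. ennreal (log_density y) * indicator (ball x (r * norm x)) y \<partial>lborel)"
    using image by (intro nn_integral_mono) (auto simp: indicator_def)
  also have "\<dots> = emeasure log_measure (ball x (r * norm x))"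
    unfolding log_measure_def by (subst emeasure_density) auto
  finally have I_le: "ennreal I \<le> emeasure log_measure (ball x (r * norm x))" .
  have I: "ennreal I = (\<integral>\<^sup>+z. ennreal (J z) * indicator S z \<partial>lborel)"
    using J_int J_pos S1 unfolding I_def
    by (subst nn_integral_has_integral_lebesgue')
       (auto intro!: integrable_integral set_lebesgue_integral_eq_integral(1) less_imp_le)
  have [measurable]: "S \<in> sets borel" by (simp add: S_def)
  \<comment> \<open>Averaging over \<open>z\<close> and \<open>- z\<close> makes the integrand radial, with \<open>1 - (norm z)\<^sup>2\<close> as denominator.\<close>
  have mJ: "(\<lambda>z. ennreal (J z) * indicator S z) \<in> borel_measurable borel"
    by measurable
  have "2 * ennreal I = (\<integral>\<^sup>+z. ennreal (J z) * indicator S z \<partial>lborel) + (\<integral>\<^sup>+z. ennreal (J (- z)) * indicator S (- z) \<partial>lborel)"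
    by (subst nn_integral_lborel_reflect[OF mJ]) (simp add: I mult_2)
  also have "\<dots> = (\<integral>\<^sup>+z. ennreal (J z) * indicator S z + ennreal (J (- z)) * indicator S (- z) \<partial>lborel)"
    using mJ measurable_compose[OF _ mJ, of uminus] by (intro nn_integral_add[symmetric]) simp_all
  also have "\<dots> = (\<integral>\<^sup>+z. 2 * (ennreal (1 / (c * (1 - (norm z)\<^sup>2))) * indicator (ball 0 r) z)
      \<partial>(lborel :: (real ^ 'm::_) measure))"
  proof (rule nn_integral_cong)
    fix z :: "real ^ 'm::_"
    show "ennreal (J z) * indicator S z + ennreal (J (- z)) * indicator S (- z) =
      2 * (ennreal (1 / (c * (1 - (norm z)\<^sup>2))) * indicator (ball 0 r) z)"
    proof (cases "norm z < r")
      case True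
      then have z: "norm z < 1" using r by simp
      have eq: "half_chord k (- z) = half_chord k z"
        using norm_minus_cancel[of "offset k z"] by (simp add: half_chord_def offset_def norm_minus_commute)
      have h: "half_chord k z > 0" "half_chord k z + z $ k > 0" "half_chord k z - z $ k > 0"
        "1 - (norm z)\<^sup>2 = (half_chord k z + z $ k) * (half_chord k z - z $ k)"
        using half_chord_bounds[OF z, of k] by (auto simp: power2_eq_square algebra_simps)
      \<comment> \<open>With \<open>h = half_chord k z\<close> and \<open>s = z $ k\<close>,
        \<open>1 / (h + s) + 1 / (h - s) = 2 * h / (h^2 - s^2)\<close>, and the numerator cancels
        the remaining factor \<open>h\<close> of the denominator.\<close>
      have "J z + J (- z) = 2 * (1 / (c * (1 - (norm z)\<^sup>2)))"
        unfolding J_def eq h(4) using h(1-3) c by (simp add: divide_simps)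
      moreover have "J z \<ge> 0" "J (- z) \<ge> 0" using J_pos[of z] J_pos[of "- z"] z by auto
      moreover have "1 / (c * (1 - (norm z)\<^sup>2)) \<ge> 0" using h c by simp
      ultimately have "ennreal (J z) + ennreal (J (- z)) = ennreal 2 * ennreal (1 / (c * (1 - (norm z)\<^sup>2)))"
        by (metis ennreal_plus ennreal_mult zero_le_numeral)
      then show ?thesis using True by (simp add: S_def)
    qed (simp add: S_def)
  qed
  also have "\<dots> = 2 * (\<integral>\<^sup>+z. ennreal (1 / (c * (1 - (norm z)\<^sup>2))) * indicator (ball 0 r) z \<partial>(lborel :: (real ^ 'm::_) measure))"
    unfolding S_def[symmetric] by (intro nn_integral_cmult) measurable
  also have "\<dots> = 2 * ennreal (ball_bound d r)"
    using nn_integral_ball_radial[OF r, where 'a = "real ^ 'm::_"] by (simp add: c_def d_def)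
  finally have "ennreal I = ennreal (ball_bound d r)"
    by (simp add: ennreal_mult_cancel_left)
  then show ?thesis using I_le by (simp add: d_def)
qed

section \<open>Separated sequences\<close>

lemma kappa_eq_exp_ball_bound: "kappa d = exp (ball_bound d (1 / 2))"
  by (simp add: kappa_def ball_bound_def)

lemma ball_bound_nonneg:
  assumes "r < 1"
  shows "0 \<le> ball_bound d r"
  unfolding ball_bound_def
proof (rule integral_nonneg)
  show "(\<lambda>t. t ^ (d - 1) / (1 - t\<^sup>2)) integrable_on {0..r}"
    by (intro integrable_continuous_real continuous_on_ball_bound_integrand assms)
  fix t assume t: "t \<in> {0..r}"
  then have "t\<^sup>2 < 1" using assms by (simp add: abs_square_less_1)
  then show "0 \<le> t ^ (d - 1) / (1 - t\<^sup>2)" using t by simp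
qed

text \<open>The integrand is at most \<open>4/3\<close> on \<open>[0, 1/2]\<close>, so shrinking the
  radius from \<open>1/2\<close> to \<open>\<rho> / 2\<close> loses at most
  \<open>2/3 * (1 - \<rho>)\<close>, which is below
  \<open>1 - \<rho> \<le> - ln \<rho>\<close>.\<close>

lemma ln_add_ln_kappa_le_ball_bound:
  assumes "0 < \<rho>" "\<rho> \<le> 1"
  shows "ln \<rho> + ln (kappa d) \<le> ball_bound d (\<rho> / 2)"
proof -
  define g where "g = (\<lambda>t::real. t ^ (d - 1) / (1 - t\<^sup>2))"
  have int: "g integrable_on {0..1/2}"
    unfolding g_def by (intro integrable_continuous_real continuous_on_ball_bound_integrand) simp
  have "ball_bound d (1 / 2) = ball_bound d (\<rho> / 2) + integral {\<rho>/2..1/2} g"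
    unfolding ball_bound_def g_def[symmetric] using assms int
    by (intro Henstock_Kurzweil_Integration.integral_combine[symmetric]) auto
  moreover have "integral {\<rho>/2..1/2} g \<le> integral {\<rho>/2..1/2} (\<lambda>_. 4 / 3)"
  proof (rule integral_le)
    show "g integrable_on {\<rho>/2..1/2}"
      using int by (rule integrable_on_subinterval) (use assms in auto)
    fix t assume t: "t \<in> {\<rho>/2..1/2}"
    then have "0 \<le> t" "t \<le> 1 / 2" using assms by auto
    then have "t\<^sup>2 \<le> (1 / 2)\<^sup>2" by (intro power_mono) auto
    then have "1 - t\<^sup>2 \<ge> 3 / 4" by (simp add: power2_eq_square)
    moreover have "t ^ (d - 1) \<le> 1" using \<open>0 \<le> t\<close> \<open>t \<le> 1 / 2\<close> by (intro power_le_one) auto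
    ultimately have "g t \<le> 1 / (3 / 4)"
      unfolding g_def using \<open>0 \<le> t\<close> by (intro frac_le) auto
    then show "g t \<le> 4 / 3" by simp
  qed auto
  ultimately have "ball_bound d (1 / 2) \<le> ball_bound d (\<rho> / 2) + (1 - \<rho>)"
    using assms by simp
  moreover have "ln \<rho> \<le> \<rho> - 1" using assms by (intro ln_le_minus_one) auto
  ultimately show ?thesis by (simp add: kappa_eq_exp_ball_bound)
qed

lemma no_expanding_separated_sequence_wellorder:
  fixes y :: "nat \<Rightarrow> real ^ 'm :: {finite, wellorder}"
  assumes K: "0 < K" "K < kappa CARD('m)"
    and \<delta>_pos: "\<And>k. 0 < \<delta> k" and \<delta>_mono: "\<And>i j. i \<le> j \<Longrightarrow> \<delta> i \<le> \<delta> j"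
    and sep: "\<And>i j. i < j \<Longrightarrow> \<delta> j \<le> norm (y j - y i)"
    and \<delta>_le: "\<And>k. \<delta> k \<le> norm (y k)"
    and step: "\<And>k. norm (y (Suc k)) \<le> K * \<delta> k"
  shows False
proof -
  define d where "d = CARD('m)"
  define \<epsilon> where "\<epsilon> = ln (kappa d) - ln K"
  define \<rho> where "\<rho> = (\<lambda>k. \<delta> k / norm (y k))"
  \<comment> \<open>Chosen so that every earlier norm is at most \<open>Q * norm (y n)\<close>:
    \<open>K\<close> handles the successors, the quotient handles \<open>y 0\<close>.\<close>
  define Q where "Q = max K (norm (y 0) / \<delta> 0)"
  have \<epsilon>: "\<epsilon> > 0" using K by (simp add: \<epsilon>_def d_def)
  have y_pos: "norm (y k) > 0" for k using \<delta>_pos[of k] \<delta>_le[of k] by linarith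
  have \<rho>: "0 < \<rho> k" "\<rho> k \<le> 1" for k
    using \<delta>_pos[of k] \<delta>_le[of k] y_pos[of k] by (auto simp: \<rho>_def)
  have log_step: "ln (norm (y (Suc k))) \<le> ln (norm (y k)) - \<epsilon> + ball_bound d (\<rho> k / 2)" for k
  proof -
    have "ln (norm (y (Suc k))) \<le> ln (K * (\<rho> k * norm (y k)))"
      using step[of k] y_pos[of k] y_pos[of "Suc k"] \<delta>_pos[of k] K(1) by (simp add: \<rho>_def)
    also have "\<dots> = ln K + ln (\<rho> k) + ln (norm (y k))"
      using K \<rho>[of k] y_pos[of k] by (simp add: ln_mult)
    finally show ?thesis
      using ln_add_ln_kappa_le_ball_bound[OF \<rho>, of k d] by (simp add: \<epsilon>_def)
  qed
  have log_sum: "ln (norm (y n)) \<le> ln (norm (y 0)) - n * \<epsilon> + (\<Sum>k<n. ball_bound d (\<rho> k / 2))" for n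
  proof (induction n)
    case (Suc n)
    then show ?case using log_step[of n] by (simp add: algebra_simps)
  qed simp
  have y_le: "norm (y k) \<le> Q * norm (y n)" if "k \<le> n" for k n
  proof -
    have Qn: "Q * \<delta> n \<le> Q * norm (y n)"
      using \<delta>_le[of n] K by (intro mult_left_mono) (auto simp: Q_def)
    have "norm (y k) \<le> Q * \<delta> n"
    proof (cases k)
      case 0
      have "norm (y 0) = norm (y 0) / \<delta> 0 * \<delta> 0" using \<delta>_pos[of 0] by simp
      also have "\<dots> \<le> Q * \<delta> n"
        using \<delta>_pos[of 0] \<delta>_mono[of 0 n] by (intro mult_mono) (auto simp: Q_def le_max_iff_disj)
      finally show ?thesis using 0 by simp
    next
      case (Suc j)
      have "norm (y k) \<le> K * \<delta> j" using step Suc by simp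
      also have "\<dots> \<le> Q * \<delta> n"
        using \<delta>_pos[of j] \<delta>_mono[of j n] K Suc that by (intro mult_mono) (auto simp: Q_def)
      finally show ?thesis .
    qed
    then show ?thesis using Qn by linarith
  qed
  have Q: "Q > 0" using K by (simp add: Q_def)
  have sum_le: "(\<Sum>k<n. ball_bound d (\<rho> k / 2)) \<le> ln (norm (y n)) + ln (3 * Q / \<delta> 0)" for n
  proof -
    define B where "B = (\<lambda>k. ball (y k) (\<rho> k / 2 * norm (y k)))"
    have B: "B k = ball (y k) (\<delta> k / 2)" for k using y_pos[of k] by (simp add: B_def \<rho>_def)
    \<comment> \<open>A point of the \<open>k\<close>-th ball has norm at least
      \<open>norm (y k) - \<delta> k / 2 \<ge> \<delta> 0 / 2\<close> and at most
      \<open>3/2 * norm (y k)\<close>.\<close>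
    define a b where "a = \<delta> 0 / 2" and "b = 3 / 2 * Q * norm (y n)"
    have ab: "0 < a" "a \<le> b"
    proof -
      show "0 < a" using \<delta>_pos[of 0] by (simp add: a_def)
      have "\<delta> 0 \<le> Q * norm (y n)" using \<delta>_le[of 0] y_le[of 0 n] by simp
      then show "a \<le> b" using \<delta>_pos[of 0] by (simp add: a_def b_def)
    qed
    \<comment> \<open>As \<open>\<delta>\<close> is monotone, the two radii sum to at most
      \<open>\<delta> j\<close>, a lower bound for the distance of the centres.\<close>
    have disjoint: "B i \<inter> B j = {}" if "i < j" for i j
    proof (rule ccontr)
      assume "B i \<inter> B j \<noteq> {}"
      then obtain z where "dist (y i) z < \<delta> i / 2" "dist (y j) z < \<delta> j / 2" by (auto simp: B)
      then have "dist (y j) (y i) < \<delta> i / 2 + \<delta> j / 2"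
        using dist_triangle2[of "y j" "y i" z] by linarith
      then show False using sep[OF that] \<delta>_mono[of i j] that by (simp add: dist_norm)
    qed
    have half: "\<rho> k / 2 < 1" for k using \<rho>(2)[of k] by simp
    have "ennreal (\<Sum>k<n. ball_bound d (\<rho> k / 2)) = (\<Sum>k<n. ennreal (ball_bound d (\<rho> k / 2)))"
      using half by (intro sum_ennreal[symmetric] ball_bound_nonneg)
    also have "\<dots> \<le> (\<Sum>k<n. emeasure log_measure (B k))"
      unfolding B_def d_def
    proof (intro sum_mono emeasure_log_measure_ball)
      show "0 < \<rho> k / 2" "\<rho> k / 2 < 1" "y k \<noteq> 0" for k
        using \<rho>[of k] y_pos[of k] by auto
    qed
    also have "\<dots> = emeasure log_measure (\<Union>k<n. B k)"
    proof (rule sum_emeasure)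
      show "disjoint_family_on B {..<n}"
        unfolding disjoint_family_on_def using disjoint by (metis Int_commute nat_neq_iff)
    qed (auto simp: B)
    also have "\<dots> \<le> emeasure log_measure {z :: real ^ 'm::_. a \<le> norm z \<and> norm z \<le> b}"
    proof (rule emeasure_mono)
      show "(\<Union>k<n. B k) \<subseteq> {z. a \<le> norm z \<and> norm z \<le> b}"
      proof
        fix z assume "z \<in> (\<Union>k<n. B k)"
        then obtain k where k: "k < n" "norm (y k - z) < \<delta> k / 2" by (auto simp: B dist_norm)
        have "norm (y k) - norm z \<le> norm (y k - z)" "norm z - norm (y k) \<le> norm (y k - z)"
          using norm_triangle_ineq2[of "y k" z] norm_triangle_ineq2[of z "y k"] by (simp_all add: norm_minus_commute)
        then show "z \<in> {z. a \<le> norm z \<and> norm z \<le> b}"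
          using k \<delta>_le[of k] \<delta>_mono[of 0 k] y_le[of k n] by (simp add: a_def b_def)
      qed
      show "{z :: real ^ 'm::_. a \<le> norm z \<and> norm z \<le> b} \<in> sets log_measure"
        unfolding sets_log_measure by measurable
    qed
    also have "\<dots> = ennreal (ln (b / a))" using ab by (rule emeasure_log_measure_annulus)
    finally have "(\<Sum>k<n. ball_bound d (\<rho> k / 2)) \<le> ln (b / a)"
      using ab by (subst (asm) ennreal_le_iff) auto
    also have "b / a = norm (y n) * (3 * Q / \<delta> 0)" by (simp add: a_def b_def)
    also have "ln \<dots> = ln (norm (y n)) + ln (3 * Q / \<delta> 0)"
      using y_pos[of n] Q \<delta>_pos[of 0] by (intro ln_mult_pos) auto
    finally show ?thesis .
  qed
  \<comment> \<open>Adding \<open>log_sum\<close> and \<open>sum_le\<close> cancels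
    \<open>ln (norm (y n))\<close> and bounds \<open>n * \<epsilon>\<close> independently of
    \<open>n\<close>.\<close>
  obtain n :: nat where "ln (norm (y 0)) + ln (3 * Q / \<delta> 0) < n * \<epsilon>"
    using reals_Archimedean3[OF \<epsilon>] by blast
  then show False using log_sum[of n] sum_le[of n] by linarith
qed

text \<open>The library's change of variables needs a well-ordered index type, hence this copy of \<open>'a\<close>.\<close>

typedef ('a :: finite) index = "{..<CARD('a)}"
  by (auto intro!: exI[of _ 0])

lemma card_index: "CARD('a :: finite index) = CARD('a)"
  using type_definition.card[OF type_definition_index] by simp

instance index :: (finite) finite
proof
  show "finite (UNIV :: 'a index set)"
    using card_index[where 'a = 'a] by (intro card_ge_0_finite) simp
qed

instantiation index :: (finite) wellorder
begin

definition "i \<le> j \<longleftrightarrow> Rep_index i \<le> Rep_index j"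
definition "i < j \<longleftrightarrow> Rep_index i < Rep_index j"

instance
proof
  fix P :: "'a index \<Rightarrow> bool" and i
  assume step: "\<And>i. (\<And>j. j < i \<Longrightarrow> P j) \<Longrightarrow> P i"
  show "P i"
  proof (induction i rule: measure_induct_rule[of Rep_index])
    case (less i)
    show ?case by (rule step, rule less) (simp add: less_index_def)
  qed
qed (auto simp: less_eq_index_def less_index_def Rep_index_inject)

end

text \<open>Relabelling coordinates along a bijection of the index types is a linear isometry, so
  every hypothesis carries over.\<close>

lemma no_expanding_separated_sequence:
  fixes y :: "nat \<Rightarrow> real ^ 'd"
  assumes "0 < K" "K < kappa CARD('d)"
    and "\<And>k. 0 < \<delta> k" "\<And>i j. i \<le> j \<Longrightarrow> \<delta> i \<le> \<delta> j"
    and "\<And>i j. i < j \<Longrightarrow> \<delta> j \<le> norm (y j - y i)"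
    and "\<And>k. \<delta> k \<le> norm (y k)"
    and "\<And>k. norm (y (Suc k)) \<le> K * \<delta> k"
  shows False
proof -
  obtain \<pi> :: "'d index \<Rightarrow> 'd" where \<pi>: "bij \<pi>"
    using finite_same_card_bij[of "UNIV :: 'd index set" "UNIV :: 'd set"] by (auto simp: card_index)
  define iso :: "real ^ 'd \<Rightarrow> real ^ 'd index" where "iso = (\<lambda>x. \<chi> i. x $ \<pi> i)"
  have norm: "norm (iso x) = norm x" for x
    unfolding norm_vec_def L2_set_def iso_def
    using sum.reindex_bij_betw[OF \<pi>, of "\<lambda>i. (norm (x $ i))\<^sup>2"] by simp
  have diff: "iso x - iso z = iso (x - z)" for x z
    by (simp add: iso_def vec_eq_iff)
  show False
    by (rule no_expanding_separated_sequence_wellorder[of K \<delta> "\<lambda>k. iso (y k)"])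
      (use assms in \<open>simp_all add: norm diff card_index\<close>)
qed

section \<open>Nearest-neighbour feedback\<close>

lemma bounded_of_nearest_growth:
  fixes x :: "nat \<Rightarrow> real ^ 'd"
  assumes K: "0 \<le> K" "K < kappa CARD('d)"
    and growth: "\<And>t j. j < t \<Longrightarrow> norm (x (Suc t)) \<le> K * norm (x t - x j) + C"
  shows "bounded (range x)"
proof (rule ccontr)
  assume unbounded: "\<not> bounded (range x)"
  \<comment> \<open>At \<open>t = 0\<close> this is the minimum of the empty set, an unspecified
    value; hence the restrictions to \<open>t \<ge> 1\<close>.\<close>
  define gap where "gap = (\<lambda>t. Min ((\<lambda>j. norm (x t - x j)) ` {..<t}))"
  have gap_le: "gap t \<le> norm (x t - x j)" if "j < t" for t j
    unfolding gap_def using that by (intro Min_le) auto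
  have gap_growth: "norm (x (Suc t)) \<le> K * gap t + C" if "t \<ge> 1" for t
  proof -
    have "gap t \<in> (\<lambda>j. norm (x t - x j)) ` {..<t}"
      unfolding gap_def using that by (intro Min_in) (auto simp: lessThan_empty_iff)
    then show ?thesis using growth by auto
  qed
  \<comment> \<open>A bound on the gaps would, through \<open>gap_growth\<close>, bound all states
    from time 2 on.\<close>
  have gap_unbounded: "\<exists>t\<ge>1. R < gap t" for R
  proof (rule ccontr)
    assume "\<not> (\<exists>t\<ge>1. R < gap t)"
    then have gap_R: "gap t \<le> R" if "t \<ge> 1" for t using that by (auto simp: not_less)
    have "norm (x (Suc (Suc t))) \<le> K * R + C" for t
      using gap_growth[of "Suc t"] mult_left_mono[OF gap_R K(1), of "Suc t"] by simp
    moreover have "\<exists>s. t = 0 \<or> t = 1 \<or> t = Suc (Suc s)" for t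
      by (metis One_nat_def old.nat.exhaust)
    ultimately have "norm (x t) \<le> max (norm (x 0)) (max (norm (x 1)) (K * R + C))" for t
      by (metis max.cobounded1 max.cobounded2 max.coboundedI2)
    then show False using unbounded by (auto intro!: boundedI)
  qed
  \<comment> \<open>The margin \<open>K' - K\<close> is there to absorb additive constants, once
    \<open>\<delta>\<close> is large.\<close>
  define K' where "K' = (K + kappa CARD('d)) / 2"
  have K': "K < K'" "0 < K'" "K' < kappa CARD('d)" using K by (auto simp: K'_def)
  \<comment> \<open>Gaps above \<open>R\<close> make \<open>\<delta>\<close> positive and
    \<open>(K' - K) * \<delta>\<close> larger than \<open>K * norm (x 0) + C\<close>.\<close>
  define R where "R = norm (x 0) + max 1 ((K * norm (x 0) + C) / (K' - K))"
  have "\<exists>\<tau>. \<forall>n. (1 \<le> \<tau> n \<and> R < gap (\<tau> n)) \<and>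
    (\<tau> n < \<tau> (Suc n) \<and> gap (\<tau> n) < gap (\<tau> (Suc n)) \<and> (\<forall>s. \<tau> n \<le> s \<and> s < \<tau> (Suc n) \<longrightarrow> gap s \<le> gap (\<tau> n)))"
  proof (rule dependent_nat_choice)
    show "\<exists>t. 1 \<le> t \<and> R < gap t" by (rule gap_unbounded)
  next
    fix t n assume t: "1 \<le> t \<and> R < gap t"
    define t' where "t' = (LEAST s. t < s \<and> gap t < gap s)"
    \<comment> \<open>A gap exceeding all those up to \<open>t\<close> must occur after
      \<open>t\<close>, so the \<open>LEAST\<close> above is attained.\<close>
    obtain s where s: "Max (gap ` {..t}) < gap s" using gap_unbounded by blast
    have "gap j < gap s" if "j \<le> t" for j
      using s that Max_ge[of "gap ` {..t}" "gap j"] by simp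
    then have "t < s \<and> gap t < gap s" by (meson less_irrefl not_le order_refl)
    then have t': "t < t' \<and> gap t < gap t'"
      unfolding t'_def by (rule LeastI)
    have "gap s \<le> gap t" if "t \<le> s" "s < t'" for s
      using not_less_Least[of s "\<lambda>s. t < s \<and> gap t < gap s"] that
      by (cases "s = t") (auto simp: t'_def)
    then show "\<exists>t'. (1 \<le> t' \<and> R < gap t') \<and>
        (t < t' \<and> gap t < gap t' \<and> (\<forall>s. t \<le> s \<and> s < t' \<longrightarrow> gap s \<le> gap t))"
      using t t' by (intro exI[of _ t']) auto
  qed
  then obtain \<tau> where \<tau>: "\<And>n. 1 \<le> \<tau> n" "\<And>n. R < gap (\<tau> n)" "\<And>n. \<tau> n < \<tau> (Suc n)"
    "\<And>n. gap (\<tau> n) < gap (\<tau> (Suc n))" "\<And>n s. \<tau> n \<le> s \<Longrightarrow> s < \<tau> (Suc n) \<Longrightarrow> gap s \<le> gap (\<tau> n)"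
    by blast
  \<comment> \<open>The gap is at most the distance to \<open>x 0\<close>; subtracting
    \<open>norm (x 0)\<close> gives a quantity below the norm of the state itself.\<close>
  define \<delta> where "\<delta> = (\<lambda>n. gap (\<tau> n) - norm (x 0))"
  have \<delta>: "1 < \<delta> n" "(K * norm (x 0) + C) / (K' - K) < \<delta> n" for n
    using \<tau>(2)[of n] by (auto simp: \<delta>_def R_def)
  show False
  proof (rule no_expanding_separated_sequence[OF K'(2,3), of \<delta> "\<lambda>n. x (\<tau> n)"])
    show "0 < \<delta> n" for n using \<delta>(1)[of n] by simp
    show "\<delta> i \<le> \<delta> j" if "i \<le> j" for i j
      using lift_Suc_mono_le[of "\<lambda>n. gap (\<tau> n)", OF less_imp_le[OF \<tau>(4)] that] by (simp add: \<delta>_def)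
    show "\<delta> j \<le> norm (x (\<tau> j) - x (\<tau> i))" if "i < j" for i j
      using gap_le[OF lift_Suc_mono_less[of \<tau>, OF \<tau>(3) that]] norm_ge_zero[of "x 0"] unfolding \<delta>_def by linarith
    show "\<delta> n \<le> norm (x (\<tau> n))" for n
      using gap_le[of 0 "\<tau> n"] \<tau>(1)[of n] norm_triangle_ineq4[of "x (\<tau> n)" "x 0"] by (simp add: \<delta>_def)
    show "norm (x (\<tau> (Suc n))) \<le> K' * \<delta> n" for n
    proof -
      \<comment> \<open>The state at \<open>\<tau> (Suc n)\<close> is governed by the gap one step
        earlier, at a time from \<open>\<tau> n\<close> up to the next record, where gaps do not
        exceed \<open>gap (\<tau> n)\<close>.\<close>
      define s where "s = \<tau> (Suc n) - 1"
      have s: "\<tau> n \<le> s" "s < \<tau> (Suc n)" "Suc s = \<tau> (Suc n)" "1 \<le> s"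
        using \<tau>(3)[of n] \<tau>(1)[of n] by (auto simp: s_def)
      have "norm (x (\<tau> (Suc n))) \<le> K * gap s + C" using gap_growth[OF s(4)] s(3) by simp
      also have "\<dots> \<le> K * gap (\<tau> n) + C" using \<tau>(5)[OF s(1,2)] K(1) by (simp add: mult_left_mono)
      also have "\<dots> = K * \<delta> n + (K * norm (x 0) + C)" by (simp add: \<delta>_def algebra_simps)
      also have "K * norm (x 0) + C \<le> (K' - K) * \<delta> n"
        using \<delta>(2)[of n] K'(1) by (simp add: divide_less_eq mult.commute)
      finally show ?thesis by (simp add: algebra_simps)
    qed
  qed
qed

text \<open>The limit is at most \<open>L < L'\<close>, so the quotient itself lies below
  \<open>L'\<close> at some positive \<open>\<alpha>\<close>.\<close>

lemma plant_class_growth: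
  assumes f: "f \<in> plant_class L" and L: "0 \<le> L" "L < L'"
  obtains \<alpha> where "0 < \<alpha>" "\<And>x y. norm (f x - f y) \<le> L' * (norm (x - y) + \<alpha>)"
proof -
  have "gL_norm f \<le> ennreal L" using f by (simp add: plant_class_def)
  also have "\<dots> < ennreal L'" using L by (simp add: ennreal_less_iff)
  finally have "\<forall>\<^sub>F \<alpha> in at_top. gL_quotient f \<alpha> < ennreal L'"
    using order_tendstoD(2)[OF gL_quotient_tendsto] by blast
  then have "\<forall>\<^sub>F \<alpha> in at_top. 0 < \<alpha> \<and> gL_quotient f \<alpha> < ennreal L'"
    using eventually_gt_at_top[of "0::real"] by eventually_elim simp
  then obtain \<alpha> where \<alpha>: "0 < \<alpha>" "gL_quotient f \<alpha> < ennreal L'"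
    by (auto dest: eventually_happens)
  have "norm (f x - f y) \<le> L' * (norm (x - y) + \<alpha>)" for x y
  proof -
    have "ennreal (norm (f x - f y) / (norm (x - y) + \<alpha>)) \<le> gL_quotient f \<alpha>"
      unfolding gL_quotient_def by (intro SUP_upper2[of x] SUP_upper2[of y]) auto
    also note \<alpha>(2)
    finally have "norm (f x - f y) / (norm (x - y) + \<alpha>) < L'"
      using \<alpha>(1) by (simp add: ennreal_less_iff)
    moreover have "0 < norm (x - y) + \<alpha>" using \<alpha>(1) by (simp add: add_nonneg_pos)
    ultimately show ?thesis by (simp add: divide_less_eq)
  qed
  with \<alpha>(1) show thesis by (rule that)
qed

section \<open>The closed loop under the nearest-neighbour law\<close>

lemma is_nearest_Least:
  assumes "1 \<le> t"
  shows "is_nearest t xs (LEAST i. is_nearest t xs i)"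
proof (rule LeastI_ex)
  have "\<exists>i. is_arg_min (\<lambda>i. norm (xs ! t - xs ! i)) (\<lambda>i. i \<in> {..<t}) i"
    using assms by (intro ex_is_arg_min_if_finite) (auto simp: lessThan_empty_iff)
  then show "\<exists>i. is_nearest t xs i"
    by (auto simp: is_nearest_def is_arg_min_linorder)
qed

lemma nearest_neighbor_law_nn_feedback: "nearest_neighbor_law nn_feedback"
  using is_nearest_Least by (auto simp: nearest_neighbor_law_def nn_feedback_def)

text \<open>The response recorded at time \<open>i\<close> equals
  \<open>f (x i) + w (Suc i)\<close>, so cancelling it leaves only an increment of \<open>f\<close>
  and two disturbances.\<close>

lemma closed_loop_nn_feedback_step:
  fixes f :: "real ^ 'd \<Rightarrow> real ^ 'd" and w x0
  defines "x \<equiv> closed_loop_state nn_feedback f w x0"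
  assumes "1 \<le> t"
  shows "\<exists>i<t. (\<forall>j<t. norm (x t - x i) \<le> norm (x t - x j)) \<and>
    x (Suc t) = f (x t) - f (x i) + w (Suc t) - w (Suc i)"
proof -
  define u where "u = closed_loop_control nn_feedback f w x0"
  define xs where "xs = map x [0..<Suc t]"
  define us where "us = map u [0..<t]"
  define i where "i = (LEAST i. is_nearest t xs i)"
  note eqs = closed_loop_equations[of nn_feedback f w x0, folded x_def u_def]
  have nearest: "is_nearest t xs i" unfolding i_def using assms(2) by (rule is_nearest_Least)
  have xs: "xs ! j = x j" if "j \<le> t" for j
    using that by (simp add: xs_def del: upt_Suc)
  have i: "i < t" using nearest by (simp add: is_nearest_def)
  have "u t = - response xs us i"
    using eqs(2)[of t] assms(2) by (simp add: nn_feedback_def xs_def us_def i_def del: upt_Suc)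
  also have "response xs us i = f (x i) + w (Suc i)"
    using i xs eqs(3)[of i] by (simp add: response_def us_def)
  finally have "x (Suc t) = f (x t) - f (x i) + w (Suc t) - w (Suc i)"
    by (simp add: eqs(3)[of t])
  moreover have "norm (x t - x i) \<le> norm (x t - x j)" if "j < t" for j
    using nearest that i by (simp add: is_nearest_def xs)
  ultimately show ?thesis using i by blast
qed

theorem corollary3p10:
  shows "nearest_neighbor_law (nn_feedback :: 'd::finite feedback) \<and>
    (\<forall>L x0 f w. 0 \<le> L \<and> L < kappa CARD('d) \<longrightarrow> f \<in> plant_class L \<longrightarrow> bounded (w ` {1..}) \<longrightarrow>
      bounded (range (closed_loop_state (nn_feedback :: 'd feedback) f w x0)))"
proof (intro conjI nearest_neighbor_law_nn_feedback allI impI)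
  fix L x0 and f :: "real ^ 'd \<Rightarrow> real ^ 'd" and w :: "nat \<Rightarrow> real ^ 'd"
  assume L: "0 \<le> L \<and> L < kappa CARD('d)" and f: "f \<in> plant_class L" and w: "bounded (w ` {1..})"
  define x where "x = closed_loop_state nn_feedback f w x0"
  obtain L' where L': "L < L'" "L' < kappa CARD('d)" using L dense by blast
  obtain \<alpha> where \<alpha>: "0 < \<alpha>" "\<And>x y. norm (f x - f y) \<le> L' * (norm (x - y) + \<alpha>)"
    using plant_class_growth[OF f] L L' by blast
  obtain W where W: "\<And>t. 1 \<le> t \<Longrightarrow> norm (w t) \<le> W"
    using w by (auto simp: bounded_iff)
  \<comment> \<open>The bound at the nearest index \<open>i\<close> implies it for every
    \<open>j < t\<close>. The constant collects the offset \<open>L' * \<alpha>\<close> and two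
    disturbances, each at most \<open>W\<close>.\<close>
  have "norm (x (Suc t)) \<le> L' * norm (x t - x j) + (L' * \<alpha> + 2 * W)" if "j < t" for t j
  proof -
    have "1 \<le> t" using that by simp
    from closed_loop_nn_feedback_step[OF this, of f w x0, folded x_def]
    obtain i where "\<forall>j<t. norm (x t - x i) \<le> norm (x t - x j)"
      and i_eq: "x (Suc t) = f (x t) - f (x i) + w (Suc t) - w (Suc i)"
      by blast
    with that have i_le: "norm (x t - x i) \<le> norm (x t - x j)" by blast
    have "norm (x (Suc t)) \<le> norm (f (x t) - f (x i)) + norm (w (Suc t)) + norm (w (Suc i))"
      unfolding i_eq by norm
    also have "\<dots> \<le> L' * (norm (x t - x i) + \<alpha>) + W + W"
      using \<alpha>(2) W by (intro add_mono) auto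
    also have "L' * (norm (x t - x i) + \<alpha>) \<le> L' * (norm (x t - x j) + \<alpha>)"
      using i_le L L' by (intro mult_left_mono) auto
    finally show ?thesis by (simp add: algebra_simps)
  qed
  then show "bounded (range (closed_loop_state nn_feedback f w x0))"
    using L L' unfolding x_def[symmetric] by (intro bounded_of_nearest_growth) auto
qed

end
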